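(* Let $\mathcal Z=V(F)\subset\mathbb P^3$ be a surface of degree $d\ge2$ and $S\in\mathbb P^3$. The base points of $\Phi_{|\hat Z}$ are exactly the points $(m,[\lambda_0:\lambda_1])\in\hat Z$, $m=[x:y:z:t]$, satisfying one of the following conditions (all derivatives being evaluated at $\mathbf m$): (1) $m\in V(F,\Delta_{\mathbf S}F,Q(\nabla F))$ (i.e. $m$ is a singular point of $\mathcal Z$ or a point of tangency of $\mathcal Z$ with an isotropic plane containing $S$) and $\lambda_0=0$; (2) $t=F_x=F_y=F_z=0$ and $x^2+y^2+z^2=0$ (i.e. $m\in\mathcal C_\infty$ with $\mathcal T_m\mathcal Z=\mathcal H^\infty$) and $\lambda_0=0$; (3) $t=F_x=F_y=F_z=0$ (i.e. $\mathcal T_m\mathcal Z=\mathcal H^\infty$) and $H_F=0$ and $\lambda_0=0$; (4) $m=S\in\mathcal Z$ and $[\lambda_0:\lambda_1]$ is the unique element of $\mathbb P^1$ such that $\lambda_0\,\mathbf m+\lambda_1Q(\nabla F)\,\mathbf S=0$; (5) $m\in\mathcal C_\infty$, $[\lambda_0:\lambda_1]=[2\Delta_{\mathbf S}F\,(F_{xx}+F_{yy}+F_{zz}):2d-1]\neq[0:1]$ and $(F_{xx}+F_{yy}+F_{zz})\,\mathbf m=(2d-1)\,\boldsymbol\kappa(\nabla F)$.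
   Context: $\mathbf W=\mathbb C^4$ with coordinates $(x,y,z,t)$, $\mathbb P^3=\mathbb P(\mathbf W)$; $\mathcal H^\infty=V(t)$; $\mathbf m$ denotes a representative of $m\in\mathbb P^3$; $S=[x_0:y_0:z_0:t_0]$, $\mathbf S=(x_0,y_0,z_0,t_0)$. $Q(x,y,z,t)=x^2+y^2+z^2$, $\mathcal C_\infty=V(t,Q)$, $\boldsymbol\kappa(a,b,c,e)=(a,b,c,0)$. A plane $V(ax+by+cz+et)$ is isotropic if $a^2+b^2+c^2=0$. $\mathcal T_m\mathcal Z$ is the projective tangent plane. $F$ is homogeneous of degree $d$, $\nabla F=(F_x,F_y,F_z,F_t)$, $\operatorname{Hess}_F$ its Hessian bilinear form, $H_F$ its Hessian determinant. Set $\Delta_{\mathbf S}F=x_0F_x+y_0F_y+z_0F_z+t_0F_t$, $\boldsymbol\sigma=Q(\nabla F)\mathbf S-2\Delta_{\mathbf S}F\,\boldsymbol\kappa(\nabla F)$, $N_{\mathbf S}=(xt_0-x_0t)^2+(yt_0-y_0t)^2+(zt_0-z_0t)^2$, $$\alpha=\Delta_{\mathbf S}F,\quad \beta=-2\left[\operatorname{Hess}_F(\mathbf S,\boldsymbol\sigma)+(\Delta_{\mathbf S}F)^2(F_{xx}+F_{yy}+F_{zz})\right],\quad \gamma=-\frac{4\Delta_{\mathbf S}F}{(d-1)^2}N_{\mathbf S}H_F,$$ $Q_{\mathbf S,F}(\mathbf m,\lambda_0,\lambda_1)=\alpha(\mathbf m)\lambda_0^2+\beta(\mathbf m)\lambda_0\lambda_1+\gamma(\mathbf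 m)\lambda_1^2$. Let $\mathbb F$ be the quotient of $(\mathbf W\setminus\{0\})\times(\mathbb C^2\setminus\{0\})$ by $(\mathbf m,\lambda_0,\lambda_1)\sim(\mu\mathbf m,\mu^{2d-3}\nu\lambda_0,\nu\lambda_1)$, $\mu,\nu\in\mathbb C^*$, with points written $(m,[\lambda_0:\lambda_1])$. Set $\hat Z=\{(m,[\lambda_0:\lambda_1])\in\mathbb F:F(\mathbf m)=0,\ Q_{\mathbf S,F}(\mathbf m,\lambda_0,\lambda_1)=0\}$ and let $\Phi_{|\hat Z}:\hat Z\dashrightarrow\mathbb P^3$ be induced by $\boldsymbol\Phi(\mathbf m,\lambda_0,\lambda_1)=\lambda_0\mathbf m+\lambda_1\boldsymbol\sigma(\mathbf m)$. A base point of $\Phi_{|\hat Z}$ is a point $(m,[\lambda_0:\lambda_1])\in\hat Z$ with $\boldsymbol\Phi(\mathbf m,\lambda_0,\lambda_1)=0$. *)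

theory Defs
  imports "HOL-Analysis.Analysis" "HOL-Library.Poly_Mapping"
begin

text \<open>
  Polynomials in the coordinates of \<open>complex^'n\<close> are finitely supported maps from exponent vectors
  to coefficients. On \<open>complex^4\<close> the coordinates \<open>(x, y, z, t)\<close> carry the indices
  \<open>1, 2, 3, 4\<close>.
\<close>

type_synonym 'n cpoly = "('n \<Rightarrow>\<^sub>0 nat) \<Rightarrow>\<^sub>0 complex"

definition peval :: "'n::finite cpoly \<Rightarrow> complex^'n \<Rightarrow> complex" where
  "peval p v = (\<Sum>k\<in>Poly_Mapping.keys p.
     Poly_Mapping.lookup p k * (\<Prod>i\<in>UNIV. (v $ i) ^ Poly_Mapping.lookup k i))"

text \<open>
  The truncated exponent \<open>k - single i 1\<close> is harmless: where the exponent of variable \<open>i\<close> is \<open>0\<close>,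
  the coefficient vanishes.
\<close>

definition pderivative :: "'n::finite \<Rightarrow> 'n cpoly \<Rightarrow> 'n cpoly" where
  "pderivative i p = (\<Sum>k\<in>Poly_Mapping.keys p.
     Poly_Mapping.single (k - Poly_Mapping.single i 1)
       (of_nat (Poly_Mapping.lookup k i) * Poly_Mapping.lookup p k))"

definition homogeneous :: "nat \<Rightarrow> 'n::finite cpoly \<Rightarrow> bool" where
  "homogeneous d p \<longleftrightarrow>
     (\<forall>k\<in>Poly_Mapping.keys p. (\<Sum>i\<in>UNIV. Poly_Mapping.lookup k i) = d)"

definition grad :: "'n::finite cpoly \<Rightarrow> complex^'n \<Rightarrow> complex^'n" where
  "grad F m = (\<chi> i. peval (pderivative i F) m)"

definition hessian :: "'n::finite cpoly \<Rightarrow> complex^'n \<Rightarrow> complex^'n^'n" where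
  "hessian F m = (\<chi> i j. peval (pderivative i (pderivative j F)) m)"

text \<open>Complex bilinear pairing; the library's \<open>inner\<close> is real-valued on complex vectors.\<close>

definition cdot :: "complex^'n::finite \<Rightarrow> complex^'n \<Rightarrow> complex" where
  "cdot u v = (\<Sum>i\<in>UNIV. u $ i * v $ i)"

definition hess_form :: "'n::finite cpoly \<Rightarrow> complex^'n \<Rightarrow> complex^'n \<Rightarrow> complex^'n \<Rightarrow> complex" where
  "hess_form F m u v = cdot u (hessian F m *v v)"

definition hess_det :: "'n::finite cpoly \<Rightarrow> complex^'n \<Rightarrow> complex" where
  "hess_det F m = det (hessian F m)"


text \<open>A point of projective space is the class of its nonzero representatives.\<close>

definition proj_rel :: "((complex^'n::finite) \<times> (complex^'n)) set" where
  "proj_rel = {(u, v). u \<noteq> 0 \<and> v \<noteq> 0 \<and> (\<exists>c. c \<noteq> 0 \<and> v = c *s u)}"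

definition ppoint :: "complex^'n::finite \<Rightarrow> (complex^'n) set" where
  "ppoint v = proj_rel `` {v}"

lemma equiv_proj_rel: "equiv (UNIV - {0}) (proj_rel :: ((complex^'n::finite) \<times> (complex^'n)) set)"
proof (rule equivI)
  show "proj_rel \<subseteq> (UNIV - {0 :: complex^'n}) \<times> (UNIV - {0})"
    by (auto simp: proj_rel_def)
  show "refl_on (UNIV - {0 :: complex^'n}) proj_rel"
    by (auto simp: refl_on_def proj_rel_def intro!: exI[of _ 1])
  show "sym (proj_rel :: ((complex^'n) \<times> (complex^'n)) set)"
  proof (rule symI)
    fix u v :: "complex^'n"
    assume "(u, v) \<in> proj_rel"
    then obtain c where "u \<noteq> 0" "v \<noteq> 0" "c \<noteq> 0" "v = c *s u"
      by (auto simp: proj_rel_def)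
    then show "(v, u) \<in> proj_rel"
      by (auto simp: proj_rel_def vector_smult_assoc intro!: exI[of _ "inverse c"])
  qed
  show "trans (proj_rel :: ((complex^'n) \<times> (complex^'n)) set)"
  proof (rule transI)
    fix u v w :: "complex^'n"
    assume "(u, v) \<in> proj_rel" "(v, w) \<in> proj_rel"
    then obtain c e where "u \<noteq> 0" "w \<noteq> 0" "c \<noteq> 0" "v = c *s u" "e \<noteq> 0" "w = e *s v"
      by (auto simp: proj_rel_def)
    then show "(u, w) \<in> proj_rel"
      by (auto simp: proj_rel_def vector_smult_assoc intro!: exI[of _ "e * c"])
  qed
qed

abbreviation p1point :: "complex \<Rightarrow> complex \<Rightarrow> (complex^2) set" where
  "p1point a b \<equiv> ppoint (vector [a, b])"

definition surface :: "4 cpoly \<Rightarrow> (complex^4) set set" where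
  "surface F = {ppoint v | v. v \<noteq> 0 \<and> peval F v = 0}"

definition plane :: "complex^4 \<Rightarrow> (complex^4) set set" where
  "plane a = {ppoint v | v. v \<noteq> 0 \<and> cdot a v = 0}"

definition qform :: "complex^4 \<Rightarrow> complex" where
  "qform v = (v $ 1)\<^sup>2 + (v $ 2)\<^sup>2 + (v $ 3)\<^sup>2"

definition plane_at_infinity :: "(complex^4) set set" where
  "plane_at_infinity = {ppoint v | v. v \<noteq> 0 \<and> v $ 4 = 0}"

definition absolute_conic :: "(complex^4) set set" where
  "absolute_conic = {ppoint v | v. v \<noteq> 0 \<and> v $ 4 = 0 \<and> qform v = 0}"

definition isotropic_plane :: "(complex^4) set set \<Rightarrow> bool" where
  "isotropic_plane P \<longleftrightarrow> (\<exists>a. a \<noteq> 0 \<and> P = plane a \<and> qform a = 0)"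

definition singular_at :: "4 cpoly \<Rightarrow> complex^4 \<Rightarrow> bool" where
  "singular_at F m \<longleftrightarrow> peval F m = 0 \<and> grad F m = 0"

text \<open>Only meaningful at zeros \<open>m\<close> of \<open>F\<close> that are not singular.\<close>

definition tangent_plane :: "4 cpoly \<Rightarrow> complex^4 \<Rightarrow> (complex^4) set set" where
  "tangent_plane F m = plane (grad F m)"


definition kappa :: "complex^4 \<Rightarrow> complex^4" where
  "kappa v = (\<chi> i. if i = 4 then 0 else v $ i)"

definition Delta :: "complex^4 \<Rightarrow> 4 cpoly \<Rightarrow> complex^4 \<Rightarrow> complex" where
  "Delta S F m = cdot S (grad F m)"

definition sigma :: "complex^4 \<Rightarrow> 4 cpoly \<Rightarrow> complex^4 \<Rightarrow> complex^4" where
  "sigma S F m = qform (grad F m) *s S - (2 * Delta S F m) *s kappa (grad F m)"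

definition nform :: "complex^4 \<Rightarrow> complex^4 \<Rightarrow> complex" where
  "nform S m = (m $ 1 * S $ 4 - S $ 1 * m $ 4)\<^sup>2 + (m $ 2 * S $ 4 - S $ 2 * m $ 4)\<^sup>2
     + (m $ 3 * S $ 4 - S $ 3 * m $ 4)\<^sup>2"

text \<open>The Laplacian \<open>F\<^sub>x\<^sub>x + F\<^sub>y\<^sub>y + F\<^sub>z\<^sub>z\<close>; the variable \<open>t\<close> does not enter.\<close>

definition laplacian3 :: "4 cpoly \<Rightarrow> complex^4 \<Rightarrow> complex" where
  "laplacian3 F m = hessian F m $ 1 $ 1 + hessian F m $ 2 $ 2 + hessian F m $ 3 $ 3"

definition alpha :: "complex^4 \<Rightarrow> 4 cpoly \<Rightarrow> complex^4 \<Rightarrow> complex" where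
  "alpha S F m = Delta S F m"

definition beta :: "complex^4 \<Rightarrow> 4 cpoly \<Rightarrow> complex^4 \<Rightarrow> complex" where
  "beta S F m = - 2 * (hess_form F m S (sigma S F m) + (Delta S F m)\<^sup>2 * laplacian3 F m)"

definition gamma :: "nat \<Rightarrow> complex^4 \<Rightarrow> 4 cpoly \<Rightarrow> complex^4 \<Rightarrow> complex" where
  "gamma d S F m =
     - (4 * Delta S F m / (of_nat d - 1)\<^sup>2) * nform S m * hess_det F m"

definition QSF ::
  "nat \<Rightarrow> complex^4 \<Rightarrow> 4 cpoly \<Rightarrow> complex^4 \<Rightarrow> complex \<Rightarrow> complex \<Rightarrow> complex" where
  "QSF d S F m l0 l1 =
     alpha S F m * l0\<^sup>2 + beta S F m * l0 * l1 + gamma d S F m * l1\<^sup>2"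

definition Phi ::
  "complex^4 \<Rightarrow> 4 cpoly \<Rightarrow> complex^4 \<Rightarrow> complex \<Rightarrow> complex \<Rightarrow> complex^4" where
  "Phi S F m l0 l1 = l0 *s m + l1 *s sigma S F m"


definition FF_carrier :: "((complex^4) \<times> complex \<times> complex) set" where
  "FF_carrier = {(m, l0, l1). m \<noteq> 0 \<and> (l0, l1) \<noteq> (0, 0)}"

text \<open>The exponent \<open>2 * d - 3\<close> is a natural number, truncated for \<open>d < 2\<close>.\<close>

definition FF_rel ::
  "nat \<Rightarrow> (((complex^4) \<times> complex \<times> complex) \<times> ((complex^4) \<times> complex \<times> complex)) set" where
  "FF_rel d = {((m, l0, l1), (m', l0', l1')).
     (m, l0, l1) \<in> FF_carrier \<and> (m', l0', l1') \<in> FF_carrier \<and>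
     (\<exists>\<mu> \<nu>. \<mu> \<noteq> 0 \<and> \<nu> \<noteq> 0 \<and>
        m' = \<mu> *s m \<and> l0' = \<mu> ^ (2 * d - 3) * \<nu> * l0 \<and> l1' = \<nu> * l1)}"

lemma equiv_FF_rel: "equiv FF_carrier (FF_rel d)"
proof (rule equivI)
  show "FF_rel d \<subseteq> FF_carrier \<times> FF_carrier"
    by (auto simp: FF_rel_def)
  show "refl_on FF_carrier (FF_rel d)"
    by (auto simp: refl_on_def FF_rel_def intro!: exI[of _ 1])
  show "sym (FF_rel d)"
  proof (rule symI, clarify)
    fix m n :: "complex^4" and a b a' b' :: complex
    assume "((m, a, b), (n, a', b')) \<in> FF_rel d"
    then obtain \<mu> \<nu> where *: "(m, a, b) \<in> FF_carrier" "(n, a', b') \<in> FF_carrier"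
      "\<mu> \<noteq> 0" "\<nu> \<noteq> 0" "n = \<mu> *s m" "a' = \<mu> ^ (2 * d - 3) * \<nu> * a" "b' = \<nu> * b"
      by (auto simp: FF_rel_def)
    then have "m = inverse \<mu> *s n" "a = inverse \<mu> ^ (2 * d - 3) * inverse \<nu> * a'"
      "b = inverse \<nu> * b'"
      by (simp_all add: vector_smult_assoc power_inverse field_simps)
    with * show "((n, a', b'), (m, a, b)) \<in> FF_rel d"
      unfolding FF_rel_def by (blast dest: nonzero_imp_inverse_nonzero)
  qed
  show "trans (FF_rel d)"
  proof (rule transI, clarify)
    fix m n p :: "complex^4" and a b a' b' a'' b'' :: complex
    assume "((m, a, b), (n, a', b')) \<in> FF_rel d" "((n, a', b'), (p, a'', b'')) \<in> FF_rel d"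
    then obtain \<mu> \<nu> \<mu>' \<nu>' where *: "(m, a, b) \<in> FF_carrier" "(p, a'', b'') \<in> FF_carrier"
      "\<mu> \<noteq> 0" "\<nu> \<noteq> 0" "n = \<mu> *s m" "a' = \<mu> ^ (2 * d - 3) * \<nu> * a" "b' = \<nu> * b"
      "\<mu>' \<noteq> 0" "\<nu>' \<noteq> 0" "p = \<mu>' *s n" "a'' = \<mu>' ^ (2 * d - 3) * \<nu>' * a'" "b'' = \<nu>' * b'"
      by (auto simp: FF_rel_def)
    then have "p = (\<mu>' * \<mu>) *s m" "a'' = (\<mu>' * \<mu>) ^ (2 * d - 3) * (\<nu>' * \<nu>) * a"
      "b'' = (\<nu>' * \<nu>) * b" "\<mu>' * \<mu> \<noteq> 0" "\<nu>' * \<nu> \<noteq> 0"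
      by (simp_all add: vector_smult_assoc power_mult_distrib)
    with * show "((m, a, b), (p, a'', b'')) \<in> FF_rel d"
      unfolding FF_rel_def by blast
  qed
qed

definition FF :: "nat \<Rightarrow> ((complex^4) \<times> complex \<times> complex) set set" where
  "FF d = FF_carrier // FF_rel d"

definition Zhat ::
  "nat \<Rightarrow> complex^4 \<Rightarrow> 4 cpoly \<Rightarrow> ((complex^4) \<times> complex \<times> complex) set set" where
  "Zhat d S F =
     {P \<in> FF d. \<exists>(m, l0, l1)\<in>P. peval F m = 0 \<and> QSF d S F m l0 l1 = 0}"

definition base_points ::
  "nat \<Rightarrow> complex^4 \<Rightarrow> 4 cpoly \<Rightarrow> ((complex^4) \<times> complex \<times> complex) set set" where
  "base_points d S F = {P \<in> Zhat d S F. \<exists>(m, l0, l1)\<in>P. Phi S F m l0 l1 = 0}"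

end

theory Submission
  imports Defs
begin

text \<open>
  Let \<open>F(m) = 0\<close>. If \<open>\<lambda>\<^sub>0 m + \<lambda>\<^sub>1 \<sigma> = 0\<close> then \<open>\<lambda>\<^sub>1 \<noteq> 0\<close>. When \<open>\<lambda>\<^sub>0 = 0\<close> we have \<open>\<sigma> = 0\<close>, that is
  \<open>Q(\<nabla>F) S = 2 \<Delta> \<kappa>(\<nabla>F)\<close>, and pairing with \<open>\<nabla>F\<close> excludes \<open>\<Delta> Q(\<nabla>F) \<noteq> 0\<close>. When \<open>\<lambda>\<^sub>0 \<noteq> 0\<close> the point
  \<open>m\<close> is a multiple of \<open>\<sigma>\<close>, so Euler's relation \<open>\<nabla>F \<cdot> m = 0\<close> and \<open>\<nabla>F \<cdot> \<sigma> = - \<Delta> Q(\<nabla>F)\<close> leave the two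
  cases \<open>\<Delta> = 0\<close>, where \<open>m = S\<close>, and \<open>Q(\<nabla>F) = 0\<close>, where \<open>m\<close> is a multiple of \<open>\<kappa>(\<nabla>F)\<close>. In the
  last case \<open>\<gamma> = 0\<close> and \<open>Hess(S, m) = (d - 1) \<Delta>\<close>, so the quadratic equation becomes linear and
  determines \<open>[\<lambda>\<^sub>0 : \<lambda>\<^sub>1]\<close>.
\<close>

section \<open>Homogeneous polynomials\<close>

definition monom_val :: "('n::finite \<Rightarrow>\<^sub>0 nat) \<Rightarrow> complex^'n \<Rightarrow> complex" where
  "monom_val k v = (\<Prod>i\<in>UNIV. (v $ i) ^ Poly_Mapping.lookup k i)"

lemma monom_val_add: "monom_val (k + l) v = monom_val k v * monom_val l v"
  by (simp add: monom_val_def lookup_add power_add prod.distrib)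

lemma monom_val_single: "monom_val (Poly_Mapping.single i 1) v = v $ i"
proof -
  have "(v $ j) ^ Poly_Mapping.lookup (Poly_Mapping.single i 1) j = (if j = i then v $ i else 1)" for j
    by (simp add: lookup_single when_def)
  then show ?thesis
    by (simp add: monom_val_def)
qed

text \<open>Indices outside the support contribute zero coefficients. A common finite index set lets
  polynomials with different supports be added termwise.\<close>

lemma peval_superset:
  assumes "finite A" and "Poly_Mapping.keys p \<subseteq> A"
  shows "peval p v = (\<Sum>k\<in>A. Poly_Mapping.lookup p k * monom_val k v)"
  unfolding peval_def monom_val_def[symmetric]
  using assms by (intro sum.mono_neutral_left) (auto simp: in_keys_iff)

lemma peval_eq: "peval p v = (\<Sum>k\<in>Poly_Mapping.keys p. Poly_Mapping.lookup p k * monom_val k v)"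
  by (simp add: peval_superset)

lemma peval_0 [simp]: "peval 0 v = 0"
  by (simp add: peval_def)

lemma peval_single: "peval (Poly_Mapping.single k c) v = c * monom_val k v"
  by (subst peval_superset[of "{k}"]) (auto simp: lookup_single)

lemma peval_add: "peval (p + q) v = peval p v + peval q v"
proof -
  let ?A = "Poly_Mapping.keys p \<union> Poly_Mapping.keys q"
  have "peval (p + q) v = (\<Sum>k\<in>?A. Poly_Mapping.lookup (p + q) k * monom_val k v)"
    using Poly_Mapping.keys_add[of p q] by (intro peval_superset) auto
  also have "\<dots> = (\<Sum>k\<in>?A. Poly_Mapping.lookup p k * monom_val k v)
      + (\<Sum>k\<in>?A. Poly_Mapping.lookup q k * monom_val k v)"
    by (simp add: lookup_add ring_distribs sum.distrib)
  also have "\<dots> = peval p v + peval q v"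
    using peval_superset[of ?A p v] peval_superset[of ?A q v] by simp
  finally show ?thesis .
qed

lemma peval_sum: "finite A \<Longrightarrow> peval (\<Sum>a\<in>A. f a) v = (\<Sum>a\<in>A. peval (f a) v)"
  by (induction A rule: finite_induct) (simp_all add: peval_add)

section \<open>Coefficients and degrees of partial derivatives\<close>

lemma diff_single_eq_iff:
  assumes "Poly_Mapping.lookup l i \<noteq> 0"
  shows "l - Poly_Mapping.single i 1 = k \<longleftrightarrow> l = k + Poly_Mapping.single i (1::nat)"
proof
  assume "l - Poly_Mapping.single i 1 = k"
  then show "l = k + Poly_Mapping.single i 1"
    using assms by (auto intro!: poly_mapping_eqI simp: lookup_add lookup_minus lookup_single when_def)
qed simp

text \<open>Lowering the \<open>i\<close>-th exponent is injective on exponents that involve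
  variable \<open>i\<close>, so only one monomial of \<open>p\<close> feeds each
  coefficient.\<close>

lemma lookup_pderivative:
  "Poly_Mapping.lookup (pderivative i p) k =
     of_nat (Poly_Mapping.lookup k i + 1) * Poly_Mapping.lookup p (k + Poly_Mapping.single i 1)"
proof -
  let ?e = "Poly_Mapping.single i (1::nat)"
  have "Poly_Mapping.lookup (pderivative i p) k =
      (\<Sum>l\<in>Poly_Mapping.keys p.
        (of_nat (Poly_Mapping.lookup l i) * Poly_Mapping.lookup p l when l - ?e = k))"
    by (simp add: pderivative_def lookup_sum lookup_single)
  also have "\<dots> = (\<Sum>l\<in>Poly_Mapping.keys p. if l = k + ?e
      then of_nat (Poly_Mapping.lookup l i) * Poly_Mapping.lookup p l else 0)"
  proof (rule sum.cong)
    fix l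
    show "(of_nat (Poly_Mapping.lookup l i) * Poly_Mapping.lookup p l when l - ?e = k) =
      (if l = k + ?e then of_nat (Poly_Mapping.lookup l i) * Poly_Mapping.lookup p l else 0)"
      using diff_single_eq_iff[of l i k]
      by (cases "Poly_Mapping.lookup l i = 0") (auto simp: when_def)
  qed simp
  also have "\<dots> = of_nat (Poly_Mapping.lookup k i + 1) * Poly_Mapping.lookup p (k + ?e)"
    by (auto simp: lookup_add in_keys_iff)
  finally show ?thesis .
qed

lemma pderivative_commute: "pderivative i (pderivative j p) = pderivative j (pderivative i p)"
proof (rule poly_mapping_eqI)
  fix k
  show "Poly_Mapping.lookup (pderivative i (pderivative j p)) k =
      Poly_Mapping.lookup (pderivative j (pderivative i p)) k"
    by (cases "i = j") (simp_all add: lookup_pderivative lookup_add lookup_single add_ac)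
qed

text \<open>The truncated \<open>d - 1\<close> is correct also at \<open>d = 0\<close>: the
  derivative is then zero and has no monomials to check.\<close>

lemma homogeneous_pderivative:
  assumes "homogeneous d p"
  shows "homogeneous (d - 1) (pderivative i p)"
  unfolding homogeneous_def
proof
  fix k assume "k \<in> Poly_Mapping.keys (pderivative i p)"
  then have "k + Poly_Mapping.single i 1 \<in> Poly_Mapping.keys p"
    by (auto simp: in_keys_iff lookup_pderivative)
  then have "(\<Sum>j\<in>UNIV. Poly_Mapping.lookup (k + Poly_Mapping.single i 1) j) = d"
    using assms by (auto simp: homogeneous_def)
  then show "(\<Sum>j\<in>UNIV. Poly_Mapping.lookup k j) = d - 1"
    by (simp add: lookup_add sum.distrib lookup_single when_def)
qed

lemma peval_scale:
  assumes "homogeneous d p"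
  shows "peval p (c *s v) = c ^ d * peval p v"
proof -
  have "monom_val k (c *s v) = c ^ d * monom_val k v" if "k \<in> Poly_Mapping.keys p" for k
    using assms that
    by (auto simp: homogeneous_def monom_val_def power_mult_distrib prod.distrib
        simp flip: power_sum)
  then show ?thesis
    by (simp add: peval_eq sum_distrib_left mult_ac)
qed

text \<open>The factor \<open>v $ i\<close> restores the lowered exponent, so each monomial is an
  eigenvector whose eigenvalue is its exponent in variable \<open>i\<close>. Summing over
  \<open>i\<close> yields Euler's relation.\<close>

lemma peval_pderivative_mult:
  "v $ i * peval (pderivative i p) v =
     (\<Sum>k\<in>Poly_Mapping.keys p. of_nat (Poly_Mapping.lookup k i) * (Poly_Mapping.lookup p k * monom_val k v))"
proof -
  let ?e = "Poly_Mapping.single i (1::nat)"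
  have "v $ i * (of_nat (Poly_Mapping.lookup k i) * Poly_Mapping.lookup p k * monom_val (k - ?e) v)
      = of_nat (Poly_Mapping.lookup k i) * (Poly_Mapping.lookup p k * monom_val k v)" for k
  proof (cases "Poly_Mapping.lookup k i = 0")
    case False
    then have "k = (k - ?e) + ?e"
      using diff_single_eq_iff[of k i "k - ?e"] by simp
    then have "monom_val k v = monom_val ((k - ?e) + ?e) v"
      by (rule arg_cong)
    also have "\<dots> = monom_val (k - ?e) v * v $ i"
      by (simp only: monom_val_add monom_val_single)
    finally have "monom_val k v = monom_val (k - ?e) v * v $ i" .
    then show ?thesis by simp
  qed simp
  then show ?thesis
    unfolding pderivative_def by (simp only: peval_sum[OF finite_keys] peval_single sum_distrib_left)
qed

theorem euler_homogeneous:
  assumes "homogeneous d p"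
  shows "cdot v (grad p v) = of_nat d * peval p v"
proof -
  have "cdot v (grad p v) = (\<Sum>i\<in>UNIV. \<Sum>k\<in>Poly_Mapping.keys p.
      of_nat (Poly_Mapping.lookup k i) * (Poly_Mapping.lookup p k * monom_val k v))"
    by (simp add: cdot_def grad_def peval_pderivative_mult)
  also have "\<dots> = (\<Sum>k\<in>Poly_Mapping.keys p.
      of_nat (\<Sum>i\<in>UNIV. Poly_Mapping.lookup k i) * (Poly_Mapping.lookup p k * monom_val k v))"
    by (subst sum.swap) (simp add: sum_distrib_right)
  also have "\<dots> = (\<Sum>k\<in>Poly_Mapping.keys p. of_nat d * (Poly_Mapping.lookup p k * monom_val k v))"
    using assms by (intro sum.cong) (auto simp: homogeneous_def)
  finally show ?thesis
    by (simp add: peval_eq sum_distrib_left)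
qed

lemma grad_scale:
  assumes "homogeneous d p"
  shows "grad p (c *s v) = c ^ (d - 1) *s grad p v"
  using assms by (simp add: vec_eq_iff grad_def peval_scale[OF homogeneous_pderivative])

text \<open>The scalar is written row by row so that multilinearity of the determinant in its rows
  applies.\<close>

lemma hessian_scale:
  assumes "homogeneous d p"
  shows "hessian p (c *s v) = (\<chi> i. c ^ (d - 2) *s hessian p v $ i)"
proof -
  have "homogeneous (d - 2) (pderivative i (pderivative j p))" for i j
    using homogeneous_pderivative[OF homogeneous_pderivative[OF assms]] by (simp add: numeral_2_eq_2)
  then show ?thesis
    by (simp add: vec_eq_iff hessian_def peval_scale)
qed

text \<open>Row \<open>i\<close> is Euler's relation for the \<open>i\<close>-th partial derivative,
  once mixed partials are exchanged.\<close>

lemma hessian_mult_self: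
  assumes "homogeneous d p"
  shows "hessian p v *v v = of_nat (d - 1) *s grad p v"
proof (rule vec_eq_iff[THEN iffD2], rule allI)
  fix i
  have "(hessian p v *v v) $ i = cdot v (grad (pderivative i p) v)"
    by (simp add: matrix_vector_mult_def hessian_def cdot_def grad_def pderivative_commute[of i] mult.commute)
  also have "\<dots> = of_nat (d - 1) * peval (pderivative i p) v"
    by (rule euler_homogeneous[OF homogeneous_pderivative[OF assms]])
  finally show "(hessian p v *v v) $ i = (of_nat (d - 1) *s grad p v) $ i"
    by (simp add: grad_def)
qed

section \<open>Projective points and planes\<close>

lemma ppoint_eq_iff:
  assumes "u \<noteq> 0" "v \<noteq> 0"
  shows "ppoint u = ppoint v \<longleftrightarrow> (\<exists>c. c \<noteq> 0 \<and> v = c *s u)"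
  using assms unfolding ppoint_def
  by (subst eq_equiv_class_iff[OF equiv_proj_rel]) (auto simp: proj_rel_def)

lemma p1point_eq_iff:
  assumes "(a, b) \<noteq> (0, 0)" "(a', b') \<noteq> (0, 0)"
  shows "p1point a b = p1point a' b' \<longleftrightarrow> a * b' = a' * b"
proof -
  have "(\<exists>c. c \<noteq> 0 \<and> a' = c * a \<and> b' = c * b) \<longleftrightarrow> a * b' = a' * b"
  proof
    assume *: "a * b' = a' * b"
    show "\<exists>c. c \<noteq> 0 \<and> a' = c * a \<and> b' = c * b"
    proof (cases "a = 0")
      case True
      with assms * show ?thesis by (intro exI[of _ "b' / b"]) auto
    next
      case False
      with assms * show ?thesis by (intro exI[of _ "a' / a"]) (auto simp: field_simps)
    qed
  qed auto
  then show ?thesis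
    using assms by (subst ppoint_eq_iff) (auto simp: vec_eq_iff forall_2)
qed

text \<open>A predicate stable under nonzero scaling does not depend on the representative. This
  serves planes, the absolute conic and the surface alike.\<close>

lemma ppoint_mem_image_iff:
  assumes "v \<noteq> 0" and "\<And>c u. c \<noteq> 0 \<Longrightarrow> P u \<Longrightarrow> P (c *s u)"
  shows "ppoint v \<in> {ppoint u | u. u \<noteq> 0 \<and> P u} \<longleftrightarrow> P v"
proof
  assume "ppoint v \<in> {ppoint u | u. u \<noteq> 0 \<and> P u}"
  then obtain u where "u \<noteq> 0" "P u" "ppoint u = ppoint v" by auto
  then show "P v" using assms ppoint_eq_iff by blast
qed (use assms in blast)

lemma cdot_scale [simp]:
  "cdot (c *s u) v = c * cdot u v" "cdot u (c *s v) = c * cdot u v"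
  by (simp_all add: cdot_def sum_distrib_left mult_ac)

lemma cdot_0 [simp]: "cdot 0 v = 0" "cdot v 0 = 0"
  by (simp_all add: cdot_def)

lemma cdot_diff_right: "cdot u (v - w) = cdot u v - cdot u w"
  by (simp add: cdot_def right_diff_distrib sum_subtractf)

lemma cdot_axis_right: "cdot u (axis i c) = u $ i * c"
  by (simp add: cdot_def axis_def if_distrib cong: if_cong)

lemma cdot_commute: "cdot u v = cdot v u"
  by (simp add: cdot_def mult.commute)

lemma qform_scale [simp]: "qform (c *s v) = c\<^sup>2 * qform v"
  by (simp add: qform_def power_mult_distrib algebra_simps)

lemma ppoint_mem_plane_iff: "v \<noteq> 0 \<Longrightarrow> ppoint v \<in> plane a \<longleftrightarrow> cdot a v = 0"
  unfolding plane_def by (rule ppoint_mem_image_iff) auto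

lemma ppoint_mem_absolute_conic_iff:
  "v \<noteq> 0 \<Longrightarrow> ppoint v \<in> absolute_conic \<longleftrightarrow> v $ 4 = 0 \<and> qform v = 0"
  unfolding absolute_conic_def by (rule ppoint_mem_image_iff) auto

lemma ppoint_mem_surface_iff:
  assumes "homogeneous d F" "v \<noteq> 0"
  shows "ppoint v \<in> surface F \<longleftrightarrow> peval F v = 0"
  unfolding surface_def using assms by (intro ppoint_mem_image_iff) (auto simp: peval_scale)

text \<open>With \<open>a $ i \<noteq> 0\<close>, the vectors with entry \<open>a $ i\<close> at
  \<open>j\<close> and \<open>- a $ j\<close> at \<open>i\<close> are killed by \<open>a\<close>,
  hence by \<open>b\<close>. This makes the coefficients proportional.\<close>

lemma plane_eqD:
  assumes "plane a = plane b" and "a \<noteq> 0" and "b \<noteq> 0"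
  shows "\<exists>c. c \<noteq> 0 \<and> b = c *s a"
proof -
  obtain i where i: "a $ i \<noteq> 0" using \<open>a \<noteq> 0\<close> by (auto simp: vec_eq_iff)
  have "cdot b v = 0" if "cdot a v = 0" for v
    using that assms ppoint_mem_plane_iff[of v] by (cases "v = 0") auto
  moreover have "cdot w (axis j (a $ i) - axis i (a $ j)) = w $ j * a $ i - w $ i * a $ j" for w j
    by (simp add: cdot_diff_right cdot_axis_right)
  ultimately have "b $ j * a $ i = b $ i * a $ j" for j
    by (metis (no_types, lifting) mult.commute right_minus_eq)
  then have "b = (b $ i / a $ i) *s a"
    using i by (simp add: vec_eq_iff field_simps)
  moreover from this have "b $ i / a $ i \<noteq> 0"
    using \<open>b \<noteq> 0\<close> by (metis vector_smult_lzero)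
  ultimately show ?thesis by blast
qed

lemma plane_scale: "c \<noteq> 0 \<Longrightarrow> plane (c *s a) = plane a"
  by (simp add: plane_def)

text \<open>Any two equations of a plane are proportional and \<open>qform\<close> scales by a
  square, so the existential choice of equation is immaterial.\<close>

lemma isotropic_plane_iff: "a \<noteq> 0 \<Longrightarrow> isotropic_plane (plane a) \<longleftrightarrow> qform a = 0"
  unfolding isotropic_plane_def by (metis plane_eqD qform_scale mult_zero_right)

lemma plane_eq_infinity_iff:
  assumes "a \<noteq> 0"
  shows "plane a = plane_at_infinity \<longleftrightarrow> a $ 1 = 0 \<and> a $ 2 = 0 \<and> a $ 3 = 0"
proof -
  let ?e = "axis 4 1 :: complex^4"
  have "cdot ?e v = v $ 4" for v
    by (subst cdot_commute) (simp add: cdot_axis_right)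
  then have inf: "plane_at_infinity = plane ?e"
    by (simp add: plane_at_infinity_def plane_def)
  show ?thesis
  proof
    assume "plane a = plane_at_infinity"
    then obtain c where "a = c *s ?e"
      using plane_eqD[of ?e a] assms inf by (auto simp: axis_eq_0_iff)
    then show "a $ 1 = 0 \<and> a $ 2 = 0 \<and> a $ 3 = 0"
      by (simp add: axis_def)
  next
    assume "a $ 1 = 0 \<and> a $ 2 = 0 \<and> a $ 3 = 0"
    then have "a = (a $ 4) *s ?e" and "a $ 4 \<noteq> 0"
      using assms by (auto simp: vec_eq_iff forall_4 axis_def)
    then show "plane a = plane_at_infinity"
      using plane_scale inf by metis
  qed
qed

section \<open>Base points\<close>

lemma qform_kappa [simp]: "qform (kappa v) = qform v"
  by (simp add: qform_def kappa_def)

lemma cdot_kappa_self: "cdot (kappa v) v = qform v"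
  by (simp add: cdot_def sum_4 kappa_def qform_def power2_eq_square)

lemma kappa_eq_0_iff: "kappa v = 0 \<longleftrightarrow> v $ 1 = 0 \<and> v $ 2 = 0 \<and> v $ 3 = 0"
  by (simp add: vec_eq_iff forall_4 kappa_def)

lemma kappa_scale: "kappa (c *s v) = c *s kappa v"
  by (simp add: vec_eq_iff kappa_def)

text \<open>When \<open>qform (grad F m)\<close> is nonzero, \<open>sigma\<close> is that factor
  times the orthogonal reflection of \<open>S\<close> in the tangent plane; reflection reverses the
  sign of the pairing with the gradient.\<close>

lemma cdot_sigma_grad: "cdot (sigma S F m) (grad F m) = - (Delta S F m * qform (grad F m))"
proof -
  have "cdot (sigma S F m) (grad F m) =
      qform (grad F m) * cdot S (grad F m) - 2 * Delta S F m * cdot (kappa (grad F m)) (grad F m)"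
    by (simp add: sigma_def cdot_def sum_4 algebra_simps)
  then show ?thesis
    by (simp add: cdot_kappa_self Delta_def)
qed

lemma Delta_scale:
  assumes "homogeneous d F"
  shows "Delta S F (c *s m) = c ^ (d - 1) * Delta S F m"
  by (simp add: Delta_def grad_scale[OF assms])

lemma sigma_scale:
  assumes "homogeneous d F"
  shows "sigma S F (c *s m) = c ^ (2 * d - 2) *s sigma S F m"
proof -
  have "c ^ (2 * d - 2) = c ^ (d - 1) * c ^ (d - 1)"
    by (simp add: diff_mult_distrib2 flip: power_add mult_2)
  then show ?thesis
    by (simp add: sigma_def Delta_scale[OF assms] grad_scale[OF assms] kappa_scale vec_eq_iff power2_eq_square
        algebra_simps)
qed

lemma hess_form_self:
  assumes "homogeneous d F"
  shows "hess_form F m u m = of_nat (d - 1) * cdot u (grad F m)"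
  by (simp add: hess_form_def hessian_mult_self[OF assms] del: of_nat_diff)

lemma grad_cdot_zero:
  assumes "homogeneous d F" "peval F m = 0"
  shows "cdot (grad F m) m = 0"
  using euler_homogeneous[OF assms(1), of m] assms(2) by (simp add: cdot_commute)

text \<open>Since \<open>m\<close> is a multiple of \<open>S\<close>, the vector equation is one
  linear form in \<open>(k0, k1)\<close>, nonzero because \<open>c \<noteq> 0\<close>. It has
  exactly one zero in the projective line.\<close>

lemma residual_line_eq_iff:
  assumes S: "S \<noteq> 0" and m: "m = c *s S" "c \<noteq> 0" and l: "(l0, l1) \<noteq> (0, 0)"
  shows "{p1point k0 k1 | k0 k1. (k0, k1) \<noteq> (0, 0) \<and> k0 *s m + (k1 * q) *s S = 0} = {p1point l0 l1}
     \<longleftrightarrow> l0 *s m + (l1 * q) *s S = 0"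
proof -
  have eq: "k0 *s m + (k1 * q) *s S = 0 \<longleftrightarrow> k0 * c + k1 * q = 0" for k0 k1
  proof -
    have "k0 *s m + (k1 * q) *s S = (k0 * c + k1 * q) *s S"
      by (simp add: m vec_eq_iff algebra_simps)
    then show ?thesis using S by (simp only: vector_mul_eq_0) simp
  qed
  have one_solution: "p1point k0 k1 = p1point l0 l1 \<longleftrightarrow> l0 * c + l1 * q = 0"
    if "(k0, k1) \<noteq> (0, 0)" and k: "k0 * c + k1 * q = 0" for k0 k1
  proof -
    have "k1 \<noteq> 0" using that m by auto
    \<comment> \<open>Modulo the equation for \<open>(k0, k1)\<close>, the cross product deciding
      equality of the two points is a nonzero multiple of the form at
      \<open>(l0, l1)\<close>.\<close>
    have "(k0 * l1 - l0 * k1) * c = - k1 * (l0 * c + l1 * q) + l1 * (k0 * c + k1 * q)"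
      by algebra
    then have "k0 * l1 = l0 * k1 \<longleftrightarrow> l0 * c + l1 * q = 0"
      using \<open>k1 \<noteq> 0\<close> m k by auto
    then show ?thesis using p1point_eq_iff[OF that(1) l] by simp
  qed
  let ?K = "{p1point k0 k1 | k0 k1. (k0, k1) \<noteq> (0, 0) \<and> k0 * c + k1 * q = 0}"
  have "?K = {p1point l0 l1} \<longleftrightarrow> l0 * c + l1 * q = 0"
  proof
    assume K: "?K = {p1point l0 l1}"
    \<comment> \<open>An explicit zero of the form, to be compared with the sole element of the
      singleton.\<close>
    have q: "(- q, c) \<noteq> (0, 0)" "- q * c + c * q = 0"
      using m by auto
    then have "p1point (- q) c \<in> ?K" by blast
    then have "p1point (- q) c = p1point l0 l1" unfolding K by simp
    then show "l0 * c + l1 * q = 0" using one_solution[OF q] by simp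
  next
    assume 0: "l0 * c + l1 * q = 0"
    show "?K = {p1point l0 l1}"
    proof (intro equalityI subsetI)
      fix x assume "x \<in> ?K"
      then show "x \<in> {p1point l0 l1}" using one_solution 0 by auto
    qed (use l 0 in auto)
  qed
  then show ?thesis unfolding eq .
qed

text \<open>A nonzero gradient is an equation of the tangent plane: \<open>Delta\<close> tests
  whether \<open>S\<close> lies on it and \<open>qform\<close> tests isotropy. A zero gradient is
  the singular case.\<close>

lemma Delta_qform_zero_iff:
  assumes "S \<noteq> 0" "peval F m = 0"
  shows "Delta S F m = 0 \<and> qform (grad F m) = 0 \<longleftrightarrow>
     singular_at F m
     \<or> (\<not> singular_at F m \<and> isotropic_plane (tangent_plane F m)
          \<and> ppoint S \<in> tangent_plane F m)"
proof (cases "grad F m = 0")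
  case True
  then show ?thesis using assms by (auto simp: singular_at_def Delta_def qform_def)
next
  case False
  then show ?thesis
    using isotropic_plane_iff[OF False] ppoint_mem_plane_iff[OF assms(1), of "grad F m"]
    by (auto simp: singular_at_def Delta_def tangent_plane_def cdot_commute)
qed

text \<open>If only the \<open>t\<close>-derivative survives, Euler's relation reads
  \<open>F_t * t = 0\<close>, which forces \<open>t = 0\<close>.\<close>

lemma tangent_plane_infinity_iff:
  assumes "homogeneous d F" "peval F m = 0" "\<not> singular_at F m"
  shows "m $ 4 = 0 \<and> grad F m $ 1 = 0 \<and> grad F m $ 2 = 0 \<and> grad F m $ 3 = 0 \<longleftrightarrow>
     tangent_plane F m = plane_at_infinity"
proof -
  have g: "grad F m \<noteq> 0" using assms by (simp add: singular_at_def)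
  have "m $ 4 = 0" if "grad F m $ 1 = 0" "grad F m $ 2 = 0" "grad F m $ 3 = 0"
    using grad_cdot_zero[OF assms(1,2)] that g
    by (auto simp: cdot_def sum_4 vec_eq_iff forall_4)
  then show ?thesis
    using plane_eq_infinity_iff[OF g] by (auto simp: tangent_plane_def)
qed

section \<open>Invariance under scaling and the equations on one representative\<close>

context
  fixes F :: "4 cpoly" and d :: nat and S :: "complex^4"
  assumes d: "d \<ge> 2" and hom: "homogeneous d F" and S: "S \<noteq> 0"
begin

lemma Phi_scale:
  "Phi S F (\<mu> *s m) (\<mu> ^ (2 * d - 3) * \<nu> * l0) (\<nu> * l1) = (\<mu> ^ (2 * d - 2) * \<nu>) *s Phi S F m l0 l1"
proof -
  have "2 * d - 2 = Suc (2 * d - 3)"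
    using d by simp
  then have "\<mu> ^ (2 * d - 2) = \<mu> ^ (2 * d - 3) * \<mu>"
    by (simp only: power_Suc2)
  then show ?thesis
    by (simp add: Phi_def sigma_scale[OF hom] vec_eq_iff algebra_simps)
qed

text \<open>The coefficients have degrees \<open>d - 1\<close>, \<open>3 * d - 4\<close> and
  \<open>5 * d - 7\<close>; giving \<open>l0\<close> the weight \<open>2 * d - 3\<close> brings
  every term to weight \<open>5 * d - 7\<close>.\<close>

lemma QSF_scale:
  "QSF d S F (\<mu> *s m) (\<mu> ^ (2 * d - 3) * \<nu> * l0) (\<nu> * l1) =
     \<mu> ^ (5 * d - 7) * \<nu>\<^sup>2 * QSF d S F m l0 l1"
proof -
  \<comment> \<open>In terms of \<open>e = d - 2\<close> all exponents are free of truncated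
    subtraction.\<close>
  obtain e where e: "d = e + 2"
    using d by (metis add.commute le_Suc_ex)
  have H: "hessian F (\<mu> *s m) = (\<chi> i. \<mu> ^ e *s hessian F m $ i)"
    using hessian_scale[OF hom] e by simp
  have det: "hess_det F (\<mu> *s m) = \<mu> ^ (4 * e) * hess_det F m"
    unfolding hess_det_def H by (simp add: det_rows_mul vec_lambda_eta power_mult[symmetric] mult.commute)
  have lap: "laplacian3 F (\<mu> *s m) = \<mu> ^ e * laplacian3 F m"
    by (simp add: laplacian3_def H algebra_simps)
  have form: "hess_form F (\<mu> *s m) u (c *s v) = \<mu> ^ e * c * hess_form F m u v" for u v c
    by (simp add: hess_form_def H cdot_def matrix_vector_mult_def sum_distrib_left mult_ac)
  have n: "nform S (\<mu> *s m) = \<mu>\<^sup>2 * nform S m"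
    by (simp add: nform_def power2_eq_square algebra_simps)
  have D: "Delta S F (\<mu> *s m) = \<mu> ^ (e + 1) * Delta S F m"
    using Delta_scale[OF hom] e by simp
  have s: "sigma S F (\<mu> *s m) = \<mu> ^ (2 * e + 2) *s sigma S F m"
    using sigma_scale[OF hom] e by simp
  have a: "alpha S F (\<mu> *s m) = \<mu> ^ (e + 1) * alpha S F m"
    by (simp add: alpha_def D)
  have b: "beta S F (\<mu> *s m) = \<mu> ^ (3 * e + 2) * beta S F m"
    unfolding beta_def s form lap D
    by (simp add: algebra_simps power2_eq_square power_mult[symmetric] power_add power3_eq_cube power_mult)
  have c: "gamma d S F (\<mu> *s m) = \<mu> ^ (5 * e + 3) * gamma d S F m"
  proof -
    have "5 * e + 3 = (e + 1) + 2 + 4 * e" by simp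
    then have "\<mu> ^ (5 * e + 3) = \<mu> ^ (e + 1) * \<mu>\<^sup>2 * \<mu> ^ (4 * e)"
      by (simp only: power_add)
    then show ?thesis
      unfolding gamma_def D n det by simp
  qed
  have 1: "5 * d - 7 = 5 * e + 3" "2 * d - 3 = 2 * e + 1"
    using e by auto
  have "(e + 1) + (2 * e + 1) * 2 = 5 * e + 3" "(3 * e + 2) + (2 * e + 1) = 5 * e + 3"
    by simp_all
  then have "\<mu> ^ (e + 1) * (\<mu> ^ (2 * e + 1))\<^sup>2 = \<mu> ^ (5 * e + 3)"
    "\<mu> ^ (3 * e + 2) * \<mu> ^ (2 * e + 1) = \<mu> ^ (5 * e + 3)"
    by (metis power_add power_mult)+
  moreover have "A * a * (B * \<nu> * l0)\<^sup>2 + C * b * (B * \<nu> * l0) * (\<nu> * l1) + E * c * (\<nu> * l1)\<^sup>2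
      = E * \<nu>\<^sup>2 * (a * l0\<^sup>2 + b * l0 * l1 + c * l1\<^sup>2)"
    if "A * B\<^sup>2 = E" "C * B = E" for A B C E a b c :: complex
  proof -
    have "A * a * (B * \<nu> * l0)\<^sup>2 + C * b * (B * \<nu> * l0) * (\<nu> * l1) + E * c * (\<nu> * l1)\<^sup>2
        = \<nu>\<^sup>2 * ((A * B\<^sup>2) * a * l0\<^sup>2 + (C * B) * b * l0 * l1 + E * c * l1\<^sup>2)"
      by (simp add: power2_eq_square algebra_simps)
    then show ?thesis
      unfolding that by (simp add: algebra_simps)
  qed
  ultimately show ?thesis
    unfolding QSF_def a b c 1 by blast
qed

lemma Phi_eq_zero_iff:
  assumes m: "m \<noteq> 0" and l: "(l0, l1) \<noteq> (0, 0)" and F: "peval F m = 0"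
    and Q: "QSF d S F m l0 l1 = 0"
  shows "Phi S F m l0 l1 = 0 \<longleftrightarrow>
          (peval F m = 0 \<and> Delta S F m = 0 \<and> qform (grad F m) = 0 \<and> l0 = 0)
        \<or> (m $ 4 = 0 \<and> grad F m $ 1 = 0 \<and> grad F m $ 2 = 0 \<and> grad F m $ 3 = 0
             \<and> (m $ 1)\<^sup>2 + (m $ 2)\<^sup>2 + (m $ 3)\<^sup>2 = 0 \<and> l0 = 0)
        \<or> (m $ 4 = 0 \<and> grad F m $ 1 = 0 \<and> grad F m $ 2 = 0 \<and> grad F m $ 3 = 0
             \<and> hess_det F m = 0 \<and> l0 = 0)
        \<or> (ppoint m = ppoint S \<and> ppoint S \<in> surface F
             \<and> {p1point k0 k1 | k0 k1. (k0, k1) \<noteq> (0, 0)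
                   \<and> k0 *s m + (k1 * qform (grad F m)) *s S = 0} = {p1point l0 l1})
        \<or> (ppoint m \<in> absolute_conic
             \<and> p1point l0 l1 = p1point (2 * Delta S F m * laplacian3 F m) (2 * of_nat d - 1)
             \<and> p1point (2 * Delta S F m * laplacian3 F m) (2 * of_nat d - 1) \<noteq> p1point 0 1
             \<and> laplacian3 F m *s m = (2 * of_nat d - 1) *s kappa (grad F m))"
    (is "_ \<longleftrightarrow> ?c1 \<or> ?c2 \<or> ?c3 \<or> ?c4 \<or> ?c5")
proof -
  define g where "g = grad F m"
  define D where "D = Delta S F m"
  define q where "q = qform g"
  define L where "L = laplacian3 F m"
  define \<sigma> where "\<sigma> = sigma S F m"
  define n where "n = (2 * of_nat d - 1 :: complex)"
  have \<sigma>: "\<sigma> = q *s S - (2 * D) *s kappa g"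
    by (simp add: \<sigma>_def sigma_def q_def D_def g_def)
  have Phi: "Phi S F m l0 l1 = l0 *s m + l1 *s \<sigma>"
    by (simp add: Phi_def \<sigma>_def)
  have D: "D = cdot S g"
    by (simp add: D_def Delta_def g_def)
  have gm: "cdot g m = 0"
    using grad_cdot_zero[OF hom F] by (simp add: g_def)
  have \<sigma>g: "cdot \<sigma> g = - (D * q)"
    by (simp add: \<sigma>_def cdot_sigma_grad D_def q_def g_def)
  have "n = of_nat (2 * d - 1)"
    using d by (simp add: n_def of_nat_diff)
  then have n: "n \<noteq> 0"
    using d by (simp del: of_nat_diff)
  \<comment> \<open>As \<open>2 * d - 1\<close> is nonzero, cross-multiplication applies, and the
    point differs from [0:1] exactly when \<open>D * L \<noteq> 0\<close>.\<close>
  have c5: "?c5 \<longleftrightarrow> m $ 4 = 0 \<and> qform m = 0 \<and> l0 * n = 2 * D * L * l1 \<and> D * L \<noteq> 0 \<and> L *s m = n *s kappa g"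
    unfolding ppoint_mem_absolute_conic_iff[OF m] n_def[symmetric] D_def[symmetric] L_def[symmetric]
      g_def[symmetric]
    using n l by (auto simp: p1point_eq_iff)
  \<comment> \<open>At infinity \<open>nform\<close> is a multiple of \<open>qform\<close>, so
    \<open>gamma\<close> vanishes on the absolute conic.\<close>
  have Nt: "nform S m = (S $ 4)\<^sup>2 * qform m" if "m $ 4 = 0"
    using that by (simp add: nform_def qform_def power_mult_distrib algebra_simps)
  have c4: "?c4 \<longleftrightarrow> (\<exists>c. c \<noteq> 0 \<and> m = c *s S) \<and> l0 *s m + (l1 * q) *s S = 0"
  proof (cases "ppoint S = ppoint m")
    case True
    then obtain c where "m = c *s S" "c \<noteq> 0"
      using ppoint_eq_iff[OF S m] by auto
    moreover have "ppoint S \<in> surface F"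
      using True ppoint_mem_surface_iff[OF hom m] F by simp
    ultimately show ?thesis
      unfolding g_def[symmetric] q_def[symmetric]
      using residual_line_eq_iff[OF S _ _ l] True by auto
  next
    case False
    then show ?thesis
      using ppoint_eq_iff[OF S m] by auto
  qed
  show ?thesis
  proof
    assume "Phi S F m l0 l1 = 0"
    then have 0: "l0 *s m + l1 *s \<sigma> = 0" by (simp add: Phi)
    have l1: "l1 \<noteq> 0" using 0 l m by auto
    show "?c1 \<or> ?c2 \<or> ?c3 \<or> ?c4 \<or> ?c5"
    proof (cases "l0 = 0")
      case True
      then have \<sigma>0: "\<sigma> = 0" using 0 l1 by simp
      then have Dq: "D = 0 \<or> q = 0" using \<sigma>g by simp
      show ?thesis
      proof (cases "D = 0")
        case True
        then have "q = 0" using \<sigma>0 \<sigma> S by simp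
        then show ?thesis using True F \<open>l0 = 0\<close> by (simp add: D_def q_def g_def)
      next
        case False
        then have "kappa g = 0" using Dq \<sigma>0 \<sigma> by simp
        then have g: "g $ 1 = 0" "g $ 2 = 0" "g $ 3 = 0" by (simp_all add: kappa_eq_0_iff)
        \<comment> \<open>Only the \<open>t\<close>-components survive in \<open>D\<close>, so
          \<open>g $ 4\<close> is nonzero and Euler's relation puts \<open>m\<close> at
          infinity.\<close>
        have "S $ 4 * g $ 4 \<noteq> 0" using False D g by (simp add: cdot_def sum_4)
        moreover have "g $ 4 * m $ 4 = 0" using gm g by (simp add: cdot_def sum_4)
        ultimately have t: "m $ 4 = 0" "S $ 4 \<noteq> 0" by auto
        \<comment> \<open>With \<open>l0 = 0\<close> the quadratic equation is
          \<open>gamma * l1^2 = 0\<close>. The factors of \<open>gamma\<close> then separate the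
          second and third alternatives.\<close>
        have "gamma d S F m = 0" using Q True l1 by (simp add: QSF_def)
        moreover have "of_nat d - 1 \<noteq> (0::complex)" using d by simp
        ultimately have "qform m = 0 \<or> hess_det F m = 0"
          using False t Nt by (simp add: gamma_def D_def)
        then show ?thesis using t g True by (auto simp: qform_def g_def)
      qed
    next
      case l0: False
      have "0 = cdot (l0 *s m + l1 *s \<sigma>) g" using 0 by simp
      also have "\<dots> = l0 * cdot g m + l1 * cdot \<sigma> g"
        by (simp add: cdot_def sum_4 algebra_simps)
      finally have Dq: "D = 0 \<or> q = 0" using gm \<sigma>g l1 by simp
      have m\<sigma>: "m = (- l1 / l0) *s \<sigma>"
      proof -
        have "l0 * m $ i + l1 * \<sigma> $ i = 0" for i
          using 0 by (simp add: vec_eq_iff)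
        then have "l0 * m $ i = - l1 * \<sigma> $ i" for i
          by (simp add: eq_neg_iff_add_eq_0)
        then show ?thesis using l0 by (simp add: vec_eq_iff field_simps)
      qed
      show ?thesis
      proof (cases "D = 0")
        case True
        then have \<sigma>S: "\<sigma> = q *s S" using \<sigma> by simp
        then have mS: "m = (- l1 * q / l0) *s S" using m\<sigma> by simp
        \<comment> \<open>The scalar cannot vanish because \<open>m\<close> does not.\<close>
        then have "- l1 * q / l0 \<noteq> 0" using m by (metis vector_smult_lzero)
        moreover have "l0 *s m + (l1 * q) *s S = 0" using 0 \<sigma>S by simp
        ultimately have ?c4 using mS unfolding c4 by blast
        then show ?thesis by (rule disjI2[OF disjI2[OF disjI2[OF disjI1]]])
      next
        case False
        then have q: "q = 0" using Dq by simp
        have m\<kappa>: "m = (2 * l1 * D / l0) *s kappa g"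
          using m\<sigma> \<sigma> q by (simp add: vec_eq_iff)
        have t: "m $ 4 = 0" by (subst m\<kappa>) (simp add: kappa_def)
        have qm: "qform m = 0" using q by (subst m\<kappa>) (simp add: q_def)
        \<comment> \<open>Here \<open>\<sigma>\<close> is a multiple of \<open>m\<close>, so Euler's
          relation evaluates the Hessian term of \<open>beta\<close>.\<close>
        have \<sigma>m: "\<sigma> = (- l0 / l1) *s m" using m\<sigma> l0 l1 by simp
        have "hess_form F m S \<sigma> = (- l0 / l1) * hess_form F m S m"
          unfolding \<sigma>m by (simp only: hess_form_def vector_scalar_commute cdot_scale)
        also have "\<dots> = (- l0 / l1) * ((of_nat d - 1) * D)"
          using d by (simp add: hess_form_self[OF hom] D g_def of_nat_diff)
        finally have h: "l1 * hess_form F m S \<sigma> = - l0 * (of_nat d - 1) * D"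
          using l1 by simp
        have "gamma d S F m = 0" using Nt[OF t] qm by (simp add: gamma_def)
        \<comment> \<open>Without \<open>gamma\<close> the quadratic form is divisible by
          \<open>l0\<close>, and the nonzero \<open>l0\<close> can be cancelled.\<close>
        then have "l0 * (D * l0 - 2 * (l1 * hess_form F m S \<sigma> + l1 * D\<^sup>2 * L)) = 0"
          using Q by (simp add: QSF_def alpha_def beta_def D_def[symmetric] L_def[symmetric]
              \<sigma>_def[symmetric] power2_eq_square algebra_simps)
        then have "D * l0 - 2 * (- l0 * (of_nat d - 1) * D + l1 * D\<^sup>2 * L) = 0"
          using l0 h by simp
        \<comment> \<open>The constant arises as \<open>1 + 2 * (d - 1) = 2 * d - 1\<close>, the
          second summand coming from the Hessian term.\<close>
        then have "D * (l0 * n - 2 * D * L * l1) = 0"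
          by (simp add: n_def power2_eq_square algebra_simps)
        then have ln: "l0 * n = 2 * D * L * l1" using False by simp
        then have L: "D * L \<noteq> 0" using l0 n by auto
        have "l0 * (L * m $ i) = l0 * (n * kappa g $ i)" for i
        proof -
          have "l0 * m $ i = 2 * l1 * D * kappa g $ i"
            using arg_cong[OF m\<kappa>, of "\<lambda>v. l0 * v $ i"] l0 by simp
          then show ?thesis using ln by algebra
        qed
        then have "L *s m = n *s kappa g" using l0 by (simp add: vec_eq_iff)
        then have ?c5 unfolding c5 using t qm ln L by blast
        then show ?thesis by (intro disjI2)
      qed
    qed
  next
    \<comment> \<open>Covers the second and third alternatives: \<open>kappa g = 0\<close> also
      gives \<open>q = 0\<close>, so both terms of \<open>\<sigma>\<close> vanish.\<close>
    have kappa0: "l0 *s m + l1 *s \<sigma> = 0" if "kappa g = 0" "l0 = 0"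
    proof -
      have "q = 0" using that by (simp add: q_def kappa_eq_0_iff qform_def)
      then show ?thesis using that unfolding \<sigma> by simp
    qed
    assume "?c1 \<or> ?c2 \<or> ?c3 \<or> ?c4 \<or> ?c5"
    then show "Phi S F m l0 l1 = 0"
      unfolding Phi
    proof (elim disjE)
      assume ?c1
      then show "l0 *s m + l1 *s \<sigma> = 0" unfolding \<sigma> by (simp add: D_def q_def g_def)
    next
      assume ?c2
      then show "l0 *s m + l1 *s \<sigma> = 0" using kappa0 by (simp add: kappa_eq_0_iff g_def)
    next
      assume ?c3
      then show "l0 *s m + l1 *s \<sigma> = 0" using kappa0 by (simp add: kappa_eq_0_iff g_def)
    next
      assume ?c4
      then obtain c where c: "c \<noteq> 0" "m = c *s S" and 0: "l0 *s m + (l1 * q) *s S = 0"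
        unfolding c4 by blast
      \<comment> \<open>Since \<open>m\<close> is a nonzero multiple of \<open>S\<close>, Euler's
        relation at \<open>m\<close> says that \<open>S\<close> pairs to zero with the
        gradient.\<close>
      have "D = 0" using gm c by (simp add: D cdot_commute)
      then show "l0 *s m + l1 *s \<sigma> = 0" using 0 unfolding \<sigma> by simp
    next
      assume ?c5
      then have *: "qform m = 0" "l0 * n = 2 * D * L * l1" "D * L \<noteq> 0" "L *s m = n *s kappa g"
        unfolding c5 by auto
      \<comment> \<open>Applying \<open>qform\<close> to the vector equation carries isotropy of
        \<open>m\<close> over to the gradient.\<close>
      have "n\<^sup>2 * q = L\<^sup>2 * qform m"
        using arg_cong[OF *(4), of qform] by (simp add: q_def)
      then have "q = 0" using * n by simp
      \<comment> \<open>Both sides equal \<open>2 * D * L * l1 * m $ i\<close>; the nonzero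
        \<open>n\<close> is cancelled afterwards.\<close>
      moreover have "n * (l0 * m $ i) = n * (2 * l1 * D * kappa g $ i)" for i
      proof -
        have "L * m $ i = n * kappa g $ i" using *(4) by (simp add: vec_eq_iff)
        then show ?thesis using *(2) by algebra
      qed
      ultimately show "l0 *s m + l1 *s \<sigma> = 0" using n unfolding \<sigma> by (simp add: vec_eq_iff)
    qed
  qed
qed

text \<open>\<open>Zhat\<close> and \<open>base_points\<close> ask for some representative
  satisfying the equations; the scaling laws carry these to the given one.\<close>

lemma Zhat_memD:
  assumes P: "P \<in> Zhat d S F" and p: "(m, l0, l1) \<in> P"
  shows "m \<noteq> 0" "(l0, l1) \<noteq> (0, 0)" "peval F m = 0" "QSF d S F m l0 l1 = 0"
    "P \<in> base_points d S F \<longleftrightarrow> Phi S F m l0 l1 = 0"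
proof -
  have rel: "\<exists>\<mu> \<nu>. \<mu> \<noteq> 0 \<and> \<nu> \<noteq> 0 \<and> m = \<mu> *s m' \<and> l0 = \<mu> ^ (2 * d - 3) * \<nu> * l0' \<and> l1 = \<nu> * l1'"
    if "(m', l0', l1') \<in> P" for m' l0' l1'
  proof -
    have "((m', l0', l1'), (m, l0, l1)) \<in> FF_rel d"
      using quotient_eq_iff[OF equiv_FF_rel _ _ that p] P by (auto simp: Zhat_def FF_def)
    then show ?thesis by (auto simp: FF_rel_def)
  qed
  have "P \<in> FF_carrier // FF_rel d" using P by (simp add: Zhat_def FF_def)
  then have "P \<subseteq> FF_carrier"
    using in_quotient_imp_subset[OF equiv_FF_rel] by blast
  then show "m \<noteq> 0" "(l0, l1) \<noteq> (0, 0)" using p by (auto simp: FF_carrier_def)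
  obtain m' l0' l1' where 1: "(m', l0', l1') \<in> P" "peval F m' = 0" "QSF d S F m' l0' l1' = 0"
    using P by (auto simp: Zhat_def)
  from rel[OF 1(1)] 1(2,3) show "peval F m = 0" "QSF d S F m l0 l1 = 0"
    by (auto simp: peval_scale[OF hom] QSF_scale)
  have "Phi S F m l0 l1 = 0" if "(m', l0', l1') \<in> P" "Phi S F m' l0' l1' = 0" for m' l0' l1'
    using rel[OF that(1)] that(2) by (auto simp: Phi_scale)
  then show "P \<in> base_points d S F \<longleftrightarrow> Phi S F m l0 l1 = 0"
    using P p by (auto simp: base_points_def)
qed

end

theorem proposition25:
  fixes F :: "4 cpoly" and d :: nat and S :: "complex^4"
  assumes "d \<ge> 2" and "F \<noteq> 0" and "homogeneous d F" and "S \<noteq> 0"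
  shows
    "(\<forall>P\<in>Zhat d S F. \<forall>(m, l0, l1)\<in>P.
        P \<in> base_points d S F \<longleftrightarrow>
          (peval F m = 0 \<and> Delta S F m = 0 \<and> qform (grad F m) = 0 \<and> l0 = 0)
        \<or> (m $ 4 = 0 \<and> grad F m $ 1 = 0 \<and> grad F m $ 2 = 0 \<and> grad F m $ 3 = 0
             \<and> (m $ 1)\<^sup>2 + (m $ 2)\<^sup>2 + (m $ 3)\<^sup>2 = 0 \<and> l0 = 0)
        \<or> (m $ 4 = 0 \<and> grad F m $ 1 = 0 \<and> grad F m $ 2 = 0 \<and> grad F m $ 3 = 0
             \<and> hess_det F m = 0 \<and> l0 = 0)
        \<or> (ppoint m = ppoint S \<and> ppoint S \<in> surface F
             \<and> {p1point k0 k1 | k0 k1. (k0, k1) \<noteq> (0, 0)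
                   \<and> k0 *s m + (k1 * qform (grad F m)) *s S = 0} = {p1point l0 l1})
        \<or> (ppoint m \<in> absolute_conic
             \<and> p1point l0 l1 = p1point (2 * Delta S F m * laplacian3 F m) (2 * of_nat d - 1)
             \<and> p1point (2 * Delta S F m * laplacian3 F m) (2 * of_nat d - 1) \<noteq> p1point 0 1
             \<and> laplacian3 F m *s m = (2 * of_nat d - 1) *s kappa (grad F m)))
     \<and> (\<forall>m. m \<noteq> 0 \<and> peval F m = 0 \<longrightarrow>
          (Delta S F m = 0 \<and> qform (grad F m) = 0 \<longleftrightarrow>
             singular_at F m
             \<or> (\<not> singular_at F m \<and> isotropic_plane (tangent_plane F m)
                  \<and> ppoint S \<in> tangent_plane F m)))
     \<and> (\<forall>m. m \<noteq> 0 \<and> peval F m = 0 \<and> \<not> singular_at F m \<longrightarrow>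
          (m $ 4 = 0 \<and> grad F m $ 1 = 0 \<and> grad F m $ 2 = 0 \<and> grad F m $ 3 = 0
             \<and> (m $ 1)\<^sup>2 + (m $ 2)\<^sup>2 + (m $ 3)\<^sup>2 = 0 \<longleftrightarrow>
             ppoint m \<in> absolute_conic \<and> tangent_plane F m = plane_at_infinity))
     \<and> (\<forall>m. m \<noteq> 0 \<and> peval F m = 0 \<and> \<not> singular_at F m \<longrightarrow>
          (m $ 4 = 0 \<and> grad F m $ 1 = 0 \<and> grad F m $ 2 = 0 \<and> grad F m $ 3 = 0 \<longleftrightarrow>
             tangent_plane F m = plane_at_infinity))"
proof (intro conjI ballI allI impI)
  fix P p
  assume P: "P \<in> Zhat d S F" and p: "p \<in> P"
  obtain m l0 l1 where p_eq: "p = (m, l0, l1)"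
    by (cases p)
  note z = Zhat_memD[OF assms(1,3,4) P p[unfolded p_eq]]
  show "case p of (m, l0, l1) \<Rightarrow> P \<in> base_points d S F \<longleftrightarrow>
          (peval F m = 0 \<and> Delta S F m = 0 \<and> qform (grad F m) = 0 \<and> l0 = 0)
        \<or> (m $ 4 = 0 \<and> grad F m $ 1 = 0 \<and> grad F m $ 2 = 0 \<and> grad F m $ 3 = 0
             \<and> (m $ 1)\<^sup>2 + (m $ 2)\<^sup>2 + (m $ 3)\<^sup>2 = 0 \<and> l0 = 0)
        \<or> (m $ 4 = 0 \<and> grad F m $ 1 = 0 \<and> grad F m $ 2 = 0 \<and> grad F m $ 3 = 0
             \<and> hess_det F m = 0 \<and> l0 = 0)
        \<or> (ppoint m = ppoint S \<and> ppoint S \<in> surface F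
             \<and> {p1point k0 k1 | k0 k1. (k0, k1) \<noteq> (0, 0)
                   \<and> k0 *s m + (k1 * qform (grad F m)) *s S = 0} = {p1point l0 l1})
        \<or> (ppoint m \<in> absolute_conic
             \<and> p1point l0 l1 = p1point (2 * Delta S F m * laplacian3 F m) (2 * of_nat d - 1)
             \<and> p1point (2 * Delta S F m * laplacian3 F m) (2 * of_nat d - 1) \<noteq> p1point 0 1
             \<and> laplacian3 F m *s m = (2 * of_nat d - 1) *s kappa (grad F m))"
    unfolding p_eq prod.case z(5) by (rule Phi_eq_zero_iff[OF assms(1,3,4) z(1-4)])
next
  fix m
  assume "m \<noteq> 0 \<and> peval F m = 0"
  then show "Delta S F m = 0 \<and> qform (grad F m) = 0 \<longleftrightarrow>
             singular_at F m
             \<or> (\<not> singular_at F m \<and> isotropic_plane (tangent_plane F m)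
                  \<and> ppoint S \<in> tangent_plane F m)"
    using Delta_qform_zero_iff[OF assms(4)] by simp
next
  fix m
  assume m: "m \<noteq> 0 \<and> peval F m = 0 \<and> \<not> singular_at F m"
  \<comment> \<open>This equivalence comes first because intersecting both sides with the absolute
    conic gives the other one.\<close>
  then show inf: "m $ 4 = 0 \<and> grad F m $ 1 = 0 \<and> grad F m $ 2 = 0 \<and> grad F m $ 3 = 0 \<longleftrightarrow>
             tangent_plane F m = plane_at_infinity"
    using tangent_plane_infinity_iff[OF assms(3)] by blast
  have "ppoint m \<in> absolute_conic \<longleftrightarrow> m $ 4 = 0 \<and> (m $ 1)\<^sup>2 + (m $ 2)\<^sup>2 + (m $ 3)\<^sup>2 = 0"
    using m by (simp add: ppoint_mem_absolute_conic_iff qform_def)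
  then show "m $ 4 = 0 \<and> grad F m $ 1 = 0 \<and> grad F m $ 2 = 0 \<and> grad F m $ 3 = 0
             \<and> (m $ 1)\<^sup>2 + (m $ 2)\<^sup>2 + (m $ 3)\<^sup>2 = 0 \<longleftrightarrow>
             ppoint m \<in> absolute_conic \<and> tangent_plane F m = plane_at_infinity"
    using inf by argo
qed

end
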